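(* Let $(V_n)_{n=1}^\infty$ be a sequence of (not necessarily linear) sets of functions $V_n\subset B[0,1]$ such that the functionals $$E_n(f):=\inf\{\|f-g\|_{B[0,1]}:g\in V_n\}$$ satisfy on the Banach space $C[0,1]$, for all $m,n\in\mathbb{N}$, all $f,f_1,\dots,f_m\in C[0,1]$ and all $c\in\mathbb{R}$, $$E_{m\cdot n}\Big(\sum_{k=1}^m f_k\Big)\le\sum_{k=1}^mE_n(f_k),\quad E_n(cf)=|c|E_n(f),\quad E_n(f)\le D_n\|f\|_{B[0,1]},\quad E_n(f)\ge E_{n+1}(f),$$ with constants $D_n$ depending only on $E_n$ and not on $f$. Let $\tau:\mathbb{N}\to\mathbb{N}$, let $$G_n:=\Big\{\frac{j}{\tau(n)}:j\in\{0,1,\dots,\tau(n)\}\Big\},$$ and let $$V_{n,\tau(n)}:=\{h:G_n\to\mathbb{R}: h(x)=g(x)\text{ for all }x\in G_n\text{, for a function }g\in V_n\}.$$ Let $\varphi:[1,\infty)\to(0,\infty)$ be a strictly decreasing function with $\lim_{x\to\infty}\varphi(x)=0$ such that for each $0<\lambda<1$ there exist $X_0=X_0(\lambda)\ge\lambda^{-1}$ and $C_\lambda>0$ with $\varphi(\lambda x)\le C_\lambda\varphi(x)$ for all $x>X_0$. Suppose that for a constant $C>0$ and some $n_0\in\mathbb{N}$ $$\operatorname{VC-dim}(V_{n,\tau(n)})<\tau(n)\quad\text{and}\quad\tau(4n)\le\frac{C}{\varphi(n)}$$ for all $n\ge n_0$. Then for $r\in\mathbb{N}$ and each abstract modulus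 of smoothness $\omega$ satisfying $\lim_{\delta\to0+}\omega(\delta)/\delta=\infty$ there exists $f_\omega\in C[0,1]$ such that $$\omega_r(f_\omega,\delta)=O(\omega(\delta^r))\ (\delta\to0+)\quad\text{and}\quad E_n(f_\omega)\ne o\big(\omega([\varphi(n)]^r)\big)\ (n\to\infty).$$
   Context: $\mathbb{N}=\{1,2,\dots\}$. $B[0,1]$ is the set of bounded real-valued functions on $[0,1]$ with $\|f\|_{B[0,1]}:=\sup_{x\in[0,1]}|f(x)|$; $C[0,1]$ carries the same norm. Let $\sigma_h(x)=0$ for $x<0$ and $\sigma_h(x)=1$ for $x\ge0$. For a set $V$ of functions $g:Y\to\mathbb{R}$ on a finite set $Y\subset\mathbb{R}$, $\operatorname{VC-dim}(V)$ is the largest number $m\in\mathbb{N}$ for which $m$ (distinct) points $x_1,\dots,x_m\in Y$ exist such that for each sign sequence $s_1,\dots,s_m\in\{-1,1\}$ there is $g\in V$ with $\sigma_h(g(x_i))=\sigma_h(s_i)$ for $1\le i\le m$ (and $0$ if there is no such $m$). With $\Delta_h^rf(x):=\sum_{j=0}^r(-1)^{r-j}\binom rj f(x+jh)$, $\omega_r(f,\delta):=\sup\{|\Delta_h^rf(x)|:x\in[0,1-rh],\ 0<h\le\delta\}$ (only step sizes with $rh\le1$ contribute). An abstract modulus of smoothness is a continuous, increasing (non-decreasing) function $\omega$ on $[0,\infty)$ with $0=\omega(0)<\omega(\delta_1)\le\omega(\delta_1+\delta_2)\le\omega(\delta_1)+\omega(\delta_2)$ for all $\delta_1,\delta_2>0$.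 *)

theory Defs
  imports "HOL-Analysis.Analysis" "HOL-Library.Landau_Symbols"
begin

text \<open>
  Functions on \<open>[0,1]\<close> are represented by total functions \<open>real \<Rightarrow> real\<close>. All notions below
  only look at the values on \<open>[0,1]\<close>, so the values elsewhere are irrelevant.
\<close>

definition B01 :: "(real \<Rightarrow> real) set" where
  "B01 = {f. bounded (f ` {0..1})}"

definition C01 :: "(real \<Rightarrow> real) set" where
  "C01 = {f. continuous_on {0..1} f}"

definition norm01 :: "(real \<Rightarrow> real) \<Rightarrow> real" where
  "norm01 f = (SUP x\<in>{0..1}. \<bar>f x\<bar>)"

text \<open>
  The infimum is the intended one only for nonempty \<open>V\<close>; \<open>Inf {}\<close> is a junk value in the reals.
\<close>

definition approx_error :: "(real \<Rightarrow> real) set \<Rightarrow> (real \<Rightarrow> real) \<Rightarrow> real" where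
  "approx_error V f = (INF g\<in>V. norm01 (\<lambda>x. f x - g x))"

definition heaviside :: "real \<Rightarrow> real" where
  "heaviside x = (if x < 0 then 0 else 1)"

definition sign_shatters :: "(real \<Rightarrow> real) set \<Rightarrow> nat \<Rightarrow> (nat \<Rightarrow> real) \<Rightarrow> bool" where
  "sign_shatters V m x \<longleftrightarrow>
     (\<forall>s :: nat \<Rightarrow> real. (\<forall>i\<in>{1..m}. s i \<in> {-1, 1}) \<longrightarrow>
        (\<exists>g\<in>V. \<forall>i\<in>{1..m}. heaviside (g (x i)) = heaviside (s i)))"

text \<open>
  The set below consists of numbers \<open>m \<le> card Y\<close>, so the maximum exists whenever \<open>Y\<close> is finite,
  which is the only case in which the notion is used. The element \<open>0\<close> is the value in
  the case that no positive \<open>m\<close> qualifies.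
\<close>

definition VC_dim :: "real set \<Rightarrow> (real \<Rightarrow> real) set \<Rightarrow> nat" where
  "VC_dim Y V =
     Max (insert 0 {m. 1 \<le> m \<and>
       (\<exists>x :: nat \<Rightarrow> real. inj_on x {1..m} \<and> x ` {1..m} \<subseteq> Y \<and> sign_shatters V m x)})"

definition grid :: "nat \<Rightarrow> real set" where
  "grid t = {real j / real t | j. j \<in> {0..t}}"

text \<open>
  Functions \<open>grid t \<rightarrow> \<real>\<close> are represented by the total functions that are \<open>undefined\<close>
  outside \<open>grid t\<close>.
\<close>

definition grid_restriction :: "(real \<Rightarrow> real) set \<Rightarrow> nat \<Rightarrow> (real \<Rightarrow> real) set" where
  "grid_restriction V t = {h \<in> extensional (grid t). \<exists>g\<in>V. \<forall>x\<in>grid t. h x = g x}"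

definition fwd_diff :: "nat \<Rightarrow> real \<Rightarrow> (real \<Rightarrow> real) \<Rightarrow> real \<Rightarrow> real" where
  "fwd_diff r h f x = (\<Sum>j=0..r. (-1) ^ (r - j) * real (r choose j) * f (x + real j * h))"

text \<open>
  Step sizes with \<open>r * h > 1\<close> do not contribute, since then \<open>{0..1 - r * h}\<close> is empty.
\<close>

definition smoothness_modulus :: "nat \<Rightarrow> (real \<Rightarrow> real) \<Rightarrow> real \<Rightarrow> real" where
  "smoothness_modulus r f \<delta> =
     Sup {\<bar>fwd_diff r h f x\<bar> | x h. x \<in> {0..1 - real r * h} \<and> 0 < h \<and> h \<le> \<delta>}"

definition abstract_modulus :: "(real \<Rightarrow> real) \<Rightarrow> bool" where
  "abstract_modulus \<omega> \<longleftrightarrow>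
     continuous_on {0..} \<omega> \<and> mono_on {0..} \<omega> \<and> \<omega> 0 = 0 \<and>
     (\<forall>\<delta>1>0. \<forall>\<delta>2>0. 0 < \<omega> \<delta>1 \<and> \<omega> \<delta>1 \<le> \<omega> (\<delta>1 + \<delta>2) \<and> \<omega> (\<delta>1 + \<delta>2) \<le> \<omega> \<delta>1 + \<omega> \<delta>2)"

end

theory Submission
  imports Defs
begin

text \<open>
  The VC-dimension hypothesis says that \<open>V n\<close> cannot realise some sign pattern on the grid
  points \<open>i / \<tau> n\<close> with \<open>1 \<le> i \<le> \<tau> n\<close>. A train of smooth bumps of height \<open>\<plusminus>1\<close>, one per grid
  point, with exactly these signs is therefore at distance at least \<open>1\<close> from \<open>V n\<close>
  (\<open>VC_dim_unattained_signs\<close>, \<open>approx_error_ge_1\<close>). By scaling, its differences of order \<open>r\<close> are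
  bounded by a constant times \<open>(\<tau> n * \<delta>) ^ r\<close> (\<open>bump_train\<close>). At index \<open>4 * n\<close> the growth
  condition on \<open>\<tau>\<close> turns this into a bound by a constant times \<open>\<delta> ^ r / p n\<close>, where
  \<open>p n = \<phi> n ^ r\<close>.

  If some function \<open>g\<close> with \<open>\<bar>fwd_diff r \<delta> g x\<bar> \<le> K * \<delta> ^ r\<close> already violates
  \<open>E n g = o(\<omega> (p n))\<close>, it is the required function, because \<open>t = O(\<omega> t)\<close> at \<open>0\<close>.
  Otherwise all such smooth functions are approximated at rate \<open>o(\<omega> (p n))\<close>, and a gliding
  hump works (\<open>gliding_hump\<close>): put \<open>f = (\<Sum>k. \<omega> (p (n k)) * h (n k))\<close>, with \<open>h m\<close> the bump
  train for index \<open>4 * m\<close> and \<open>n k\<close> growing fast. Near index \<open>n k\<close> the earlier terms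
  form a smooth function, hence are approximated well, the later terms are small in norm, and the term
  \<open>k\<close> keeps \<open>E (n k) f\<close> above half of \<open>\<omega> (p (n k))\<close>. The index \<open>4 * n k\<close> is what
  allows two applications of the subadditivity of \<open>E\<close>, which doubles the index each time, to strip
  off the earlier and the later terms.

  For the modulus of smoothness, the sequence is chosen so lacunary that \<open>\<omega> (p (n k))\<close> decreases and
  \<open>\<omega> (p (n k)) / p (n k)\<close> increases geometrically; the latter is possible because
  \<open>\<omega> \<delta> / \<delta>\<close> is unbounded near \<open>0\<close>. A sum of terms
  \<open>\<omega> (p (n k)) * min 1 (t / p (n k))\<close> is then dominated by the terms with \<open>p (n k)\<close>
  next to \<open>t\<close>, which are \<open>O(\<omega> t)\<close> (\<open>lacunary_sum_le\<close>).
\<close>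

section \<open>Finite differences\<close>

text \<open>
  Pascal's rule: this recursion is what makes induction on the order of the difference possible.
\<close>

lemma fwd_diff_Suc: "fwd_diff (Suc r) h f x = fwd_diff r h f (x + h) - fwd_diff r h f x"
proof -
  define F where "F j = f (x + real j * h)" for j
  define S where "S = (\<Sum>j\<le>r. (-1) ^ (r - j) * real (r choose Suc j) * F (Suc j))"
  define T where "T = (\<Sum>j\<le>r. (-1) ^ (r - j) * real (r choose j) * F (Suc j))"
  have "fwd_diff (Suc r) h f x = (\<Sum>j\<le>Suc r. (-1) ^ (Suc r - j) * real (Suc r choose j) * F j)"
    by (simp only: fwd_diff_def F_def atLeast0AtMost)
  also have "\<dots> = (-1) ^ Suc r * F 0
      + (\<Sum>j\<le>r. (-1) ^ (r - j) * real (Suc r choose Suc j) * F (Suc j))"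
    by (subst sum.atMost_Suc_shift) simp
  also have "(\<Sum>j\<le>r. (-1) ^ (r - j) * real (Suc r choose Suc j) * F (Suc j)) = T + S"
    by (simp add: sum.distrib algebra_simps S_def T_def)
  finally have 1: "fwd_diff (Suc r) h f x = T + ((-1) ^ Suc r * F 0 + S)"
    by simp
  have "(-1) ^ Suc r * F 0 + S = (\<Sum>j\<le>Suc r. (-1) ^ (Suc r - j) * real (r choose j) * F j)"
    unfolding S_def by (subst sum.atMost_Suc_shift) simp
  also have "\<dots> = (\<Sum>j\<le>r. (-1) ^ (Suc r - j) * real (r choose j) * F j)"
    by simp
  also have "\<dots> = (\<Sum>j\<le>r. - ((-1) ^ (r - j) * real (r choose j) * F j))"
    by (rule sum.cong) (auto simp: Suc_diff_le)
  also have "\<dots> = - fwd_diff r h f x"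
    by (simp add: fwd_diff_def F_def atLeast0AtMost sum_negf)
  finally have 2: "(-1) ^ Suc r * F 0 + S = - fwd_diff r h f x" .
  have "T = fwd_diff r h f (x + h)"
    unfolding T_def fwd_diff_def F_def atLeast0AtMost
    by (rule sum.cong) (auto simp: algebra_simps)
  with 1 2 show ?thesis by simp
qed

lemma fwd_diff_0: "fwd_diff 0 h f x = f x"
  by (simp add: fwd_diff_def)

lemma fwd_diff_add: "fwd_diff r h (\<lambda>x. f x + g x) x = fwd_diff r h f x + fwd_diff r h g x"
  by (simp add: fwd_diff_def sum.distrib algebra_simps)

lemma fwd_diff_cmult: "fwd_diff r h (\<lambda>x. c * f x) x = c * fwd_diff r h f x"
  by (simp add: fwd_diff_def sum_distrib_left algebra_simps)

lemma fwd_diff_sums: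
  assumes "\<And>y. (\<lambda>k. u k y) sums f y"
  shows "(\<lambda>k. fwd_diff r h (u k) x) sums fwd_diff r h f x"
  unfolding fwd_diff_def by (intro sums_sum sums_mult assms)

lemma abs_fwd_diff_le:
  assumes "\<And>y. \<bar>f y\<bar> \<le> M"
  shows "\<bar>fwd_diff r h f x\<bar> \<le> 2 ^ r * M"
proof -
  have "\<bar>fwd_diff r h f x\<bar> \<le> (\<Sum>j\<le>r. \<bar>(-1) ^ (r - j) * real (r choose j) * f (x + real j * h)\<bar>)"
    unfolding fwd_diff_def atLeast0AtMost by (rule sum_abs)
  also have "\<dots> \<le> (\<Sum>j\<le>r. real (r choose j) * M)"
    by (rule sum_mono) (auto simp: abs_mult power_abs intro!: mult_left_mono assms)
  also have "\<dots> = real (\<Sum>j\<le>r. r choose j) * M"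
    by (simp add: sum_distrib_right)
  also have "\<dots> = 2 ^ r * M"
    by (simp add: choose_row_sum)
  finally show ?thesis .
qed

lemma has_derivative_fwd_diff:
  assumes "\<And>y. (f has_real_derivative f' y) (at y)"
  shows "(fwd_diff r h f has_real_derivative fwd_diff r h f' x) (at x)"
proof -
  have "((\<lambda>x. f (x + real j * h)) has_real_derivative f' (x + real j * h)) (at x)" for j
    using DERIV_shift[of f "f' (x + real j * h)" x "real j * h"] assms by simp
  then have "((\<lambda>x. fwd_diff r h f x) has_real_derivative fwd_diff r h f' x) (at x)"
    unfolding fwd_diff_def by (intro DERIV_sum DERIV_cmult)
  then show ?thesis .
qed

text \<open>
  \<open>F j\<close> is the \<open>j\<close>-th derivative of \<open>F 0\<close>. One application of the mean value theorem to
  the difference of order \<open>r\<close> of \<open>F 0\<close> trades one order of difference for a factor \<open>h\<close> and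
  one derivative.
\<close>

lemma abs_fwd_diff_le_derivative:
  assumes "\<And>j y. j < r \<Longrightarrow> (F j has_real_derivative F (Suc j) y) (at y)"
    and "\<And>y. \<bar>F r y\<bar> \<le> K" and "h > 0"
  shows "\<bar>fwd_diff r h (F 0) x\<bar> \<le> K * h ^ r"
  using assms(1,2)
proof (induction r arbitrary: F x)
  case 0
  then show ?case by (simp add: fwd_diff_0)
next
  case (Suc r)
  have "\<exists>z. x < z \<and> z < x + h \<and>
      fwd_diff r h (F 0) (x + h) - fwd_diff r h (F 0) x = (x + h - x) * fwd_diff r h (F (Suc 0)) z"
    using \<open>h > 0\<close> Suc.prems(1) by (intro MVT2 has_derivative_fwd_diff) auto
  then obtain z where "fwd_diff (Suc r) h (F 0) x = h * fwd_diff r h (F (Suc 0)) z"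
    by (auto simp: fwd_diff_Suc)
  moreover have "\<bar>fwd_diff r h (F (Suc 0)) z\<bar> \<le> K * h ^ r"
    using Suc.IH[of "\<lambda>j. F (Suc j)"] Suc.prems by simp
  ultimately show ?case
    using \<open>h > 0\<close> by (simp add: abs_mult mult.left_commute)
qed

lemma smoothness_modulus_bound:
  assumes "\<delta> > 0"
    and "\<And>x h. x \<in> {0..1 - real r * h} \<Longrightarrow> 0 < h \<Longrightarrow> h \<le> \<delta> \<Longrightarrow> \<bar>fwd_diff r h f x\<bar> \<le> M"
  shows "\<bar>smoothness_modulus r f \<delta>\<bar> \<le> M"
proof -
  let ?S = "{\<bar>fwd_diff r h f x\<bar> | x h. x \<in> {0..1 - real r * h} \<and> 0 < h \<and> h \<le> \<delta>}"
  \<comment> \<open>The supremum of the empty set carries no information, so some step size \<open>h \<le> \<delta>\<close> with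
    \<open>r * h \<le> 1\<close> must be exhibited; \<open>Suc r\<close> avoids division by zero.\<close>
  define h where "h = min \<delta> (1 / real (Suc r))"
  have h: "0 < h" "h \<le> \<delta>" using assms by (auto simp: h_def)
  have "real r * h \<le> real r * (1 / real (Suc r))"
    by (rule mult_left_mono) (auto simp: h_def)
  also have "\<dots> \<le> 1" by simp
  finally have mem: "\<bar>fwd_diff r h f 0\<bar> \<in> ?S" using h by fastforce
  have up: "y \<le> M" if "y \<in> ?S" for y using that assms(2) by blast
  have "bdd_above ?S" by (rule bdd_aboveI[of _ M]) (rule up)
  then have "\<bar>fwd_diff r h f 0\<bar> \<le> Sup ?S" by (rule cSup_upper[OF mem])
  moreover have "Sup ?S \<le> M" using mem by (intro cSup_least up) auto
  ultimately show ?thesis by (simp add: smoothness_modulus_def)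
qed

section \<open>Trains of smooth bumps\<close>

lemma truncated_power_derivative:
  "((\<lambda>t. max 0 t ^ Suc (Suc m)) has_real_derivative real (Suc (Suc m)) * max 0 t ^ Suc m) (at t)"
proof (cases t "0 :: real" rule: linorder_cases)
  case less
  have "((\<lambda>t::real. 0) has_real_derivative 0) (at t)" by simp
  then have "((\<lambda>t. max 0 t ^ Suc (Suc m)) has_real_derivative 0) (at t)"
    by (rule has_field_derivative_transform_within_open[of _ _ _ "{..<0}"]) (use less in auto)
  then show ?thesis using less by simp
next
  case equal
  have "isCont (\<lambda>z::real. max 0 z ^ Suc m) 0" by (intro continuous_intros)
  moreover have "max 0 z ^ Suc (Suc m) = max 0 z ^ Suc m * z" for z :: real
    by (auto simp: max_def)
  ultimately show ?thesis
    unfolding equal by (subst CARAT_DERIV) (auto intro!: exI[of _ "\<lambda>z. max 0 z ^ Suc m"])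
next
  case greater
  have "((\<lambda>t. t ^ Suc (Suc m)) has_real_derivative real (Suc (Suc m)) * t ^ Suc m) (at t)"
    by (rule derivative_eq_intros refl | simp)+
  then have "((\<lambda>t. max 0 t ^ Suc (Suc m)) has_real_derivative real (Suc (Suc m)) * t ^ Suc m) (at t)"
    by (rule has_field_derivative_transform_within_open[of _ _ _ "{0<..}"]) (use greater in auto)
  then show ?thesis using greater by simp
qed

text \<open>
  The bump is a power of the positive part of \<open>1 - 4 * y\<^sup>2\<close>, which lives on
  \<open>[-1/2, 1/2]\<close>. Differentiation maps products of such a power with a polynomial to products of the
  same kind with the exponent lowered by one, so an exponent \<open>r + 1\<close> allows \<open>r\<close>
  derivatives. The polynomial cofactor \<open>p\<close> absorbs the chain and product rules in the induction;
  the bump itself has \<open>p = 1\<close>.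
\<close>

lemma truncated_poly_derivatives:
  fixes p :: "real poly"
  shows "\<exists>B. B 0 = (\<lambda>y. max 0 (1 - 4 * y\<^sup>2) ^ Suc r * poly p y) \<and>
    (\<forall>j<r. \<forall>y. (B j has_real_derivative B (Suc j) y) (at y)) \<and>
    (\<forall>j\<le>r. \<forall>y. \<bar>y\<bar> \<ge> 1 / 2 \<longrightarrow> B j y = 0) \<and> continuous_on UNIV (B r)"
proof (induction r arbitrary: p)
  have outside: "max 0 (1 - 4 * y\<^sup>2) = 0" if "\<bar>y\<bar> \<ge> 1 / 2" for y :: real
    using power_mono[OF that, of 2] by (simp add: power_divide)
  {
    case 0
    show ?case
      by (rule exI[of _ "\<lambda>_ y. max 0 (1 - 4 * y\<^sup>2) ^ Suc 0 * poly p y"])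
        (auto simp: outside intro!: continuous_intros)
  next
    case (Suc r)
    \<comment> \<open>With \<open>u = 1 - 4 * y\<^sup>2\<close> this is \<open>(r + 2) * u' * p + u * p'\<close>, the cofactor of \<open>u ^ (r + 1)\<close>
      in the derivative of \<open>u ^ (r + 2) * p\<close>.\<close>
    define q where "q = smult (real (Suc (Suc r))) ([:0, -8:] * p) + [:1, 0, -4:] * pderiv p"
    obtain B where B: "B 0 = (\<lambda>y. max 0 (1 - 4 * y\<^sup>2) ^ Suc r * poly q y)"
      "\<And>j y. j < r \<Longrightarrow> (B j has_real_derivative B (Suc j) y) (at y)"
      "\<And>j y. j \<le> r \<Longrightarrow> \<bar>y\<bar> \<ge> 1 / 2 \<Longrightarrow> B j y = 0" "continuous_on UNIV (B r)"
      using Suc.IH[of q] by blast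
    define B' where "B' j = (case j of 0 \<Rightarrow> (\<lambda>y. max 0 (1 - 4 * y\<^sup>2) ^ Suc (Suc r) * poly p y)
       | Suc j \<Rightarrow> B j)" for j
    have step: "((\<lambda>y. max 0 (1 - 4 * y\<^sup>2) ^ Suc (Suc r) * poly p y) has_real_derivative B 0 y) (at y)" for y
    proof -
      have "((\<lambda>y::real. 1 - 4 * y\<^sup>2) has_real_derivative - 8 * y) (at y)"
        by (auto intro!: derivative_eq_intros)
      from DERIV_mult[OF DERIV_chain2[OF truncated_power_derivative this] poly_DERIV[of p y]]
      have d: "((\<lambda>y. max 0 (1 - 4 * y\<^sup>2) ^ Suc (Suc r) * poly p y) has_real_derivative
          real (Suc (Suc r)) * max 0 (1 - 4 * y\<^sup>2) ^ Suc r * (- 8 * y) * poly p y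
          + poly (pderiv p) y * max 0 (1 - 4 * y\<^sup>2) ^ Suc (Suc r)) (at y)" by simp
      have "max 0 (1 - 4 * y\<^sup>2) ^ Suc (Suc r) = max 0 (1 - 4 * y\<^sup>2) ^ Suc r * (1 - 4 * y\<^sup>2)"
        by (auto simp: max_def)
      then have "real (Suc (Suc r)) * max 0 (1 - 4 * y\<^sup>2) ^ Suc r * (- 8 * y) * poly p y
          + poly (pderiv p) y * max 0 (1 - 4 * y\<^sup>2) ^ Suc (Suc r) = B 0 y"
        unfolding B(1) q_def
        by (simp del: power_Suc of_nat_Suc) (simp only: power2_eq_square algebra_simps)
      with d show ?thesis by metis
    qed
    show ?case
    proof (intro exI[of _ B'] conjI allI impI)
      show "(B' j has_real_derivative B' (Suc j) y) (at y)" if "j < Suc r" for j y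
        using that step B(2) by (auto simp: B'_def split: nat.split)
      show "B' j y = 0" if "j \<le> Suc r" "\<bar>y\<bar> \<ge> 1 / 2" for j y
        using that B(3) outside[of y] by (auto simp: B'_def split: nat.split)
    qed (use B(4) in \<open>auto simp: B'_def\<close>)
  }
qed

text \<open>
  Integers are at distance at least \<open>1\<close> from each other, so at most one summand is nonzero.
\<close>

lemma abs_sum_disjoint_translates_le:
  fixes b :: "real \<Rightarrow> real"
  assumes supp: "\<And>y. \<bar>y\<bar> \<ge> 1 / 2 \<Longrightarrow> b y = 0" and bound: "\<And>y. \<bar>b y\<bar> \<le> K"
    and s: "\<And>i. \<bar>s i\<bar> \<le> 1"
  shows "\<bar>\<Sum>i\<in>{1..t::nat}. s i * b (z - real i)\<bar> \<le> K"
proof (cases "\<exists>i\<in>{1..t}. \<bar>z - real i\<bar> < 1 / 2")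
  case True
  then obtain k where k: "k \<in> {1..t}" "\<bar>z - real k\<bar> < 1 / 2" by blast
  have "b (z - real i) = 0" if "i \<noteq> k" for i
  proof (rule supp)
    have "\<bar>real i - real k\<bar> \<ge> 1" using that by linarith
    then show "1 / 2 \<le> \<bar>z - real i\<bar>" using k(2) by linarith
  qed
  then have "(\<Sum>i\<in>{1..t}. s i * b (z - real i)) = (\<Sum>i\<in>{1..t}. if i = k then s k * b (z - real k) else 0)"
    by (intro sum.cong) auto
  also have "\<dots> = s k * b (z - real k)" using k(1) by simp
  also have "\<bar>\<dots>\<bar> \<le> 1 * K" unfolding abs_mult using s bound by (intro mult_mono) auto
  finally show ?thesis by simp
next
  case False
  then have "b (z - real i) = 0" if "i \<in> {1..t}" for i using that by (intro supp) force
  then show ?thesis using order_trans[OF abs_ge_zero bound] by simp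
qed

text \<open>
  The translates of the bump have disjoint supports, so superposing \<open>t\<close> of them costs nothing in
  the supremum norm of any derivative; in particular the constant depends neither on
  \<open>t\<close> nor on the heights \<open>s\<close>. Compressing by the factor \<open>t\<close> multiplies the \<open>r\<close>-th
  derivative by \<open>t ^ r\<close>.
\<close>

lemma bump_train:
  "\<exists>K\<ge>0. \<forall>t\<ge>1. \<forall>s. (\<forall>i. \<bar>s i\<bar> \<le> 1) \<longrightarrow>
    (\<exists>h. continuous_on UNIV h \<and> (\<forall>y. \<bar>h y\<bar> \<le> 1) \<and> (\<forall>i\<in>{1..t}. h (real i / real t) = s i) \<and>
      (\<forall>x \<delta>. \<delta> > 0 \<longrightarrow> \<bar>fwd_diff r \<delta> h x\<bar> \<le> K * (real t * \<delta>) ^ r))"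
proof -
  obtain B where B: "B 0 = (\<lambda>y::real. max 0 (1 - 4 * y\<^sup>2) ^ Suc r * poly 1 y)"
    "\<And>j y. j < r \<Longrightarrow> (B j has_real_derivative B (Suc j) y) (at y)"
    "\<And>j y. j \<le> r \<Longrightarrow> \<bar>y\<bar> \<ge> 1 / 2 \<Longrightarrow> B j y = 0" "continuous_on UNIV (B r)"
    using truncated_poly_derivatives[of r 1] by blast
  have "compact (B r ` {-1..1})"
    using B(4) by (intro compact_continuous_image) (auto intro: continuous_on_subset)
  then obtain K where K: "\<forall>y\<in>{-1..1}. \<bar>B r y\<bar> \<le> K"
    using compact_imp_bounded[of "B r ` {-1..1}"] by (auto simp: bounded_iff)
  then have K0: "K \<ge> 0" using order_trans[OF abs_ge_zero bspec[OF K, of 0]] by simp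
  have Kb: "\<bar>B r y\<bar> \<le> K" for y
    using bspec[OF K, of y] B(3)[of r y] K0 by (cases "\<bar>y\<bar> \<ge> 1 / 2") (simp, fastforce)
  have B0: "\<bar>B 0 y\<bar> \<le> 1" for y
    unfolding B(1) by (auto simp: abs_mult power_abs max_def intro!: mult_le_one power_le_one)
  have B00: "B 0 0 = 1" unfolding B(1) by simp
  show ?thesis
  proof (intro exI[of _ K] conjI allI impI K0)
    fix t :: nat and s :: "nat \<Rightarrow> real"
    assume t: "1 \<le> t" and s: "\<forall>i. \<bar>s i\<bar> \<le> 1"
    define F where "F j x = real t ^ j * (\<Sum>i\<in>{1..t}. s i * B j (real t * x - real i))" for j x
    have deriv: "(F j has_real_derivative F (Suc j) x) (at x)" if "j < r" for j x
    proof -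
      have "((\<lambda>x. real t * x - real i) has_real_derivative real t) (at x)" for i
        by (auto intro!: derivative_eq_intros)
      from DERIV_chain2[OF B(2)[OF that] this]
      have "((\<lambda>x. real t ^ j * (\<Sum>i\<in>{1..t}. s i * B j (real t * x - real i))) has_real_derivative
          real t ^ j * (\<Sum>i\<in>{1..t}. s i * (B (Suc j) (real t * x - real i) * real t))) (at x)"
        by (intro DERIV_cmult DERIV_sum) auto
      moreover have "F j = (\<lambda>x. real t ^ j * (\<Sum>i\<in>{1..t}. s i * B j (real t * x - real i)))"
        by (simp add: fun_eq_iff F_def)
      ultimately show ?thesis by (simp add: F_def sum_distrib_left mult_ac)
    qed
    have Fr: "\<bar>F r x\<bar> \<le> real t ^ r * K" for x
      unfolding F_def abs_mult
      using abs_sum_disjoint_translates_le[of "B r" K s] B(3)[of r] Kb s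
      by (auto intro!: mult_left_mono simp: power_abs)
    have "continuous_on UNIV (B 0)" unfolding B(1) by (intro continuous_intros)
    then have "continuous_on UNIV (F 0)"
      unfolding F_def by (intro continuous_intros) (auto intro!: continuous_on_compose2[of UNIV "B 0"] continuous_intros)
    moreover have "\<bar>F 0 y\<bar> \<le> 1" for y
      unfolding F_def using abs_sum_disjoint_translates_le[of "B 0" 1 s] B(3)[of 0] B0 s by simp
    moreover have "F 0 (real i / real t) = s i" if i: "i \<in> {1..t}" for i
    proof -
      have "F 0 (real i / real t) = (\<Sum>k\<in>{1..t}. s k * B 0 (real i - real k))"
        using t by (simp add: F_def)
      also have "\<dots> = (\<Sum>k\<in>{1..t}. if k = i then s i else 0)"
      proof (rule sum.cong)
        fix k
        have "\<bar>real i - real k\<bar> \<ge> 1 / 2" if "k \<noteq> i" using that by linarith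
        then show "s k * B 0 (real i - real k) = (if k = i then s i else 0)"
          using B(3)[of 0] B00 by auto
      qed simp
      finally show ?thesis using i by simp
    qed
    moreover have "\<bar>fwd_diff r \<delta> (F 0) x\<bar> \<le> K * (real t * \<delta>) ^ r" if "\<delta> > 0" for x \<delta>
      using abs_fwd_diff_le_derivative[of r F, OF deriv Fr that] by (simp add: power_mult_distrib mult_ac)
    ultimately show "\<exists>h. continuous_on UNIV h \<and> (\<forall>y. \<bar>h y\<bar> \<le> 1) \<and>
        (\<forall>i\<in>{1..t}. h (real i / real t) = s i) \<and>
        (\<forall>x \<delta>. \<delta> > 0 \<longrightarrow> \<bar>fwd_diff r \<delta> h x\<bar> \<le> K * (real t * \<delta>) ^ r)"
      by blast
  qed
qed

section \<open>Sign patterns out of reach\<close>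

text \<open>
  The grid has \<open>t + 1\<close> points, and by hypothesis none of its \<open>t\<close>-element subsets is shattered; the
  subset omitting the point \<open>0\<close> is the one used.
\<close>

lemma VC_dim_unattained_signs:
  assumes "VC_dim (grid t) (grid_restriction V t) < t"
  obtains s :: "nat \<Rightarrow> real" where "\<And>i. s i \<in> {-1, 1}"
    "\<And>g. g \<in> V \<Longrightarrow> \<exists>i\<in>{1..t}. heaviside (g (real i / real t)) \<noteq> heaviside (s i)"
proof -
  let ?x = "\<lambda>i. real i / real t"
  define S where "S = {m. 1 \<le> m \<and> (\<exists>x :: nat \<Rightarrow> real. inj_on x {1..m} \<and> x ` {1..m} \<subseteq> grid t \<and>
     sign_shatters (grid_restriction V t) m x)}"
  have "grid t = ?x ` {0..t}" unfolding grid_def by auto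
  then have fin: "finite (grid t)" by simp
  have "m \<le> card (grid t)" if "m \<in> S" for m
    using that card_inj_on_le[of _ "{1..m}" "grid t"] fin by (fastforce simp: S_def)
  then have "finite S" by (meson finite_nat_set_iff_bounded_le)
  then have "t \<notin> S"
    using assms Max_ge[of "insert 0 S" t] unfolding VC_dim_def S_def[symmetric] by auto
  moreover have "inj_on ?x {1..t}" by (auto simp: inj_on_def)
  moreover have sub: "?x ` {1..t} \<subseteq> grid t" unfolding grid_def by auto
  ultimately have "\<not> sign_shatters (grid_restriction V t) t ?x"
    using assms unfolding S_def by auto
  then obtain s where s: "\<And>i. i \<in> {1..t} \<Longrightarrow> s i \<in> {-1, 1::real}"
    and no: "\<And>h. h \<in> grid_restriction V t \<Longrightarrow> \<exists>i\<in>{1..t}. heaviside (h (?x i)) \<noteq> heaviside (s i)"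
    unfolding sign_shatters_def by blast
  show ?thesis
  proof (rule that[of "\<lambda>i. if i \<in> {1..t} then s i else 1"])
    fix g assume "g \<in> V"
    then have "restrict g (grid t) \<in> grid_restriction V t"
      unfolding grid_restriction_def by auto
    from no[OF this] obtain i where i: "i \<in> {1..t}"
      "heaviside (restrict g (grid t) (?x i)) \<noteq> heaviside (s i)" by blast
    moreover have "?x i \<in> grid t" using sub i(1) by blast
    ultimately show "\<exists>i\<in>{1..t}. heaviside (g (?x i)) \<noteq> heaviside (if i \<in> {1..t} then s i else 1)"
      by (intro bexI[of _ i]) auto
  qed (use s in auto)
qed

text \<open>
  At a grid point where \<open>g\<close> misses the sign, \<open>h\<close> is \<open>1\<close> and \<open>g\<close> is negative, or \<open>h\<close> is
  \<open>-1\<close> and \<open>g\<close> is nonnegative; either way they differ by at least \<open>1\<close> there.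
\<close>

lemma approx_error_ge_1:
  assumes V: "V \<subseteq> B01" "V \<noteq> {}" and h: "h \<in> B01"
    and s: "\<And>i. i \<in> {1..t} \<Longrightarrow> h (real i / real t) = s i" "\<And>i. s i \<in> {-1, 1}"
    and no: "\<And>g. g \<in> V \<Longrightarrow> \<exists>i\<in>{1..t::nat}. heaviside (g (real i / real t)) \<noteq> heaviside (s i)"
  shows "approx_error V h \<ge> 1"
  unfolding approx_error_def
proof (rule cINF_greatest[OF V(2)])
  fix g assume g: "g \<in> V"
  then obtain i where i: "i \<in> {1..t}" "heaviside (g (real i / real t)) \<noteq> heaviside (s i)"
    using no by blast
  have "bounded ((\<lambda>x. h x - g x) ` {0..1})"
    using h g V(1) by (intro bounded_minus_comp) (auto simp: B01_def)
  then have "bdd_above ((\<lambda>x. \<bar>h x - g x\<bar>) ` {0..1})"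
    by (auto simp: bounded_iff bdd_above_def)
  moreover have "real i / real t \<in> {0..1}" using i(1) by auto
  ultimately have "\<bar>h (real i / real t) - g (real i / real t)\<bar> \<le> norm01 (\<lambda>x. h x - g x)"
    unfolding norm01_def by (intro cSUP_upper)
  moreover have "1 \<le> \<bar>h (real i / real t) - g (real i / real t)\<bar>"
    using i s(1)[OF i(1)] s(2)[of i] by (auto simp: heaviside_def split: if_splits)
  ultimately show "1 \<le> norm01 (\<lambda>x. h x - g x)" by linarith
qed

section \<open>Abstract moduli and lacunary sums\<close>

lemma abstract_modulus_mono:
  assumes "abstract_modulus \<omega>" "0 \<le> s" "s \<le> t"
  shows "\<omega> s \<le> \<omega> t"
  using assms unfolding abstract_modulus_def mono_on_def by auto

lemma abstract_modulus_pos: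
  assumes "abstract_modulus \<omega>" "0 < t"
  shows "0 < \<omega> t"
  using assms unfolding abstract_modulus_def by blast

text \<open>
  Subadditivity makes \<open>\<omega> t / t\<close> almost decreasing: \<open>p\<close> is at most \<open>\<lfloor>p / t\<rfloor> + 1 \<le> 2 * p / t\<close>
  steps of length \<open>t\<close>.
\<close>

lemma abstract_modulus_quotient_le:
  assumes \<omega>: "abstract_modulus \<omega>" and t: "0 < t" "t \<le> p"
  shows "\<omega> p / p \<le> 2 * (\<omega> t / t)"
proof -
  have mult: "\<omega> (real (Suc m) * t) \<le> real (Suc m) * \<omega> t" for m
  proof (induction m)
    case (Suc m)
    have "\<omega> (real (Suc m) * t + t) \<le> \<omega> (real (Suc m) * t) + \<omega> t"
      using \<omega> t unfolding abstract_modulus_def by simp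
    also have "\<dots> \<le> real (Suc (Suc m)) * \<omega> t" using Suc by (simp add: algebra_simps)
    finally show ?case by (simp add: algebra_simps)
  qed simp
  define m where "m = nat \<lfloor>p / t\<rfloor>"
  have m: "real m \<le> p / t" "p / t \<le> real (Suc m)"
    using t by (simp_all add: m_def) linarith
  have "\<omega> p \<le> \<omega> (real (Suc m) * t)"
    using t m(2) by (intro abstract_modulus_mono[OF \<omega>]) (auto simp: pos_divide_le_eq)
  also have "\<dots> \<le> real (Suc m) * \<omega> t" by (rule mult)
  also have "\<dots> \<le> (2 * (p / t)) * \<omega> t"
    using m(1) t abstract_modulus_pos[OF \<omega> t(1)] by (intro mult_right_mono) (auto simp: field_simps)
  finally show ?thesis using t by (simp add: field_simps)
qed

lemma halving_tail:
  fixes u :: "nat \<Rightarrow> real"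
  assumes "\<And>k. 0 \<le> u k" "\<And>k. u (Suc k) \<le> u k / 2"
  shows "summable u" "(\<Sum>i. u (i + k)) \<le> 2 * u k"
proof -
  have le: "u (i + k) \<le> u k * (1 / 2) ^ i" for i k
  proof (induction i)
    case (Suc i)
    then show ?case using assms(2)[of "i + k"] by simp
  qed simp
  have geo: "(\<lambda>i. u k * (1 / 2) ^ i) sums (u k * 2)" for k
    using sums_mult[OF geometric_sums[of "1 / 2 :: real"], of "u k"] by simp
  show s: "summable u"
    using le[of _ 0] assms(1) sums_summable[OF geo[of 0]]
    by (intro summable_comparison_test'[of "\<lambda>i. u 0 * (1 / 2) ^ i" 0 u]) auto
  have "(\<Sum>i. u (i + k)) \<le> (\<Sum>i. u k * (1 / 2) ^ i)"
    using le s sums_summable[OF geo] by (intro suminf_le) (auto simp: summable_iff_shift)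
  then show "(\<Sum>i. u (i + k)) \<le> 2 * u k" using sums_unique[OF geo[of k]] by simp
qed

lemma doubling_head:
  fixes q :: "nat \<Rightarrow> real"
  assumes "\<And>k. 0 \<le> q k" "\<And>k. 2 * q k \<le> q (Suc k)"
  shows "(\<Sum>k<Suc m. q k) \<le> 2 * q m"
proof (induction m)
  case 0
  then show ?case using assms(1)[of 0] by simp
next
  case (Suc m)
  then show ?case using assms(2)[of m] by simp
qed

text \<open>
  The sum is split at the first index \<open>l\<close> with \<open>p l \<le> t\<close>. From there on the bound \<open>A * \<omega> (p k)\<close>
  is geometrically decreasing and starts below \<open>A * \<omega> t\<close>. Before it, the bound
  \<open>B * t * (\<omega> (p k) / p k)\<close> is geometrically increasing, and its last value has \<open>p k > t\<close>, where
  \<open>\<omega> (p k) / p k\<close> is at most twice \<open>\<omega> t / t\<close>.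
\<close>

lemma lacunary_sum_le:
  fixes p d :: "nat \<Rightarrow> real"
  assumes \<omega>: "abstract_modulus \<omega>" and p: "\<And>k. p k > 0" "p \<longlonglongrightarrow> 0"
    and half: "\<And>k. \<omega> (p (Suc k)) \<le> \<omega> (p k) / 2"
    and double: "\<And>k. 2 * (\<omega> (p k) / p k) \<le> \<omega> (p (Suc k)) / p (Suc k)"
    and d: "\<And>k. \<bar>d k\<bar> \<le> A * \<omega> (p k)" "\<And>k. \<bar>d k\<bar> \<le> B * t * (\<omega> (p k) / p k)"
    and AB: "A \<ge> 0" "B \<ge> 0" and t: "t > 0"
  shows "\<bar>\<Sum>k. d k\<bar> \<le> (2 * A + 4 * B) * \<omega> t"
proof -
  have pos: "\<omega> (p k) > 0" for k by (rule abstract_modulus_pos[OF \<omega> p(1)])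
  have sum\<omega>: "summable (\<lambda>k. \<omega> (p k))" and tail: "(\<Sum>i. \<omega> (p (i + k))) \<le> 2 * \<omega> (p k)" for k
    using halving_tail[of "\<lambda>k. \<omega> (p k)"] pos half by (auto intro: less_imp_le)
  have sumd: "summable d"
    using d(1) summable_mult[OF sum\<omega>, of A] by (intro summable_comparison_test'[of "\<lambda>k. A * \<omega> (p k)" 0 d]) auto
  have "\<exists>k. p k \<le> t"
    using order_tendstoD(2)[OF p(2) t] by (meson eventually_sequentially less_imp_le order_refl)
  define l where "l = (LEAST k. p k \<le> t)"
  have l: "p l \<le> t" unfolding l_def by (rule LeastI_ex) fact
  have l': "t < p k" if "k < l" for k
    using not_less_Least[OF that[unfolded l_def]] by simp
  have "\<bar>\<Sum>i. d (i + l)\<bar> \<le> (\<Sum>i. A * \<omega> (p (i + l)))"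
    using norm_suminf_le[of "\<lambda>i. d (i + l)" "\<lambda>i. A * \<omega> (p (i + l))"] d(1) sum\<omega>
    by (simp add: summable_mult summable_iff_shift[of "\<lambda>k. \<omega> (p k)"])
  also have "\<dots> = A * (\<Sum>i. \<omega> (p (i + l)))"
    using sum\<omega> by (intro suminf_mult) (simp add: summable_iff_shift[of "\<lambda>k. \<omega> (p k)"])
  also have "\<dots> \<le> A * (2 * \<omega> t)"
    using tail[of l] abstract_modulus_mono[OF \<omega> _ l] p(1)[of l] AB
    by (intro mult_left_mono) (auto intro: order_trans)
  finally have hi: "\<bar>\<Sum>i. d (i + l)\<bar> \<le> 2 * A * \<omega> t" by simp
  have lo: "\<bar>\<Sum>k<l. d k\<bar> \<le> 4 * B * \<omega> t"
  proof (cases l)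
    case 0
    then show ?thesis using AB abstract_modulus_pos[OF \<omega> t] by simp
  next
    case (Suc m)
    have "\<bar>\<Sum>k<l. d k\<bar> \<le> (\<Sum>k<l. \<bar>d k\<bar>)" by (rule sum_abs)
    also have "\<dots> \<le> (\<Sum>k<l. B * t * (\<omega> (p k) / p k))" by (intro sum_mono d(2))
    also have "\<dots> = B * t * (\<Sum>k<Suc m. \<omega> (p k) / p k)"
      unfolding Suc by (rule sum_distrib_left[symmetric])
    also have "\<dots> \<le> B * t * (2 * (\<omega> (p m) / p m))"
      using doubling_head[of "\<lambda>k. \<omega> (p k) / p k" m, OF less_imp_le[OF divide_pos_pos[OF pos p(1)]] double]
        AB t
      by (intro mult_left_mono) auto
    also have "\<dots> \<le> B * t * (2 * (2 * (\<omega> t / t)))"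
      using abstract_modulus_quotient_le[OF \<omega> t, of "p m"] l'[of m] Suc AB t
      by (intro mult_left_mono) auto
    finally show ?thesis using t by simp
  qed
  have "(\<Sum>k. d k) = (\<Sum>i. d (i + l)) + (\<Sum>k<l. d k)"
    by (rule suminf_split_initial_segment[OF sumd])
  with hi lo show ?thesis by (simp add: algebra_simps)
qed

section \<open>The gliding hump\<close>

text \<open>
  The continuous functions whose \<open>r\<close>-th modulus of smoothness is \<open>O(\<delta> ^ r)\<close>. Describing
  the class by differences instead of derivatives keeps it independent of
  the values outside \<open>[0,1]\<close>.
\<close>

definition r_smooth :: "nat \<Rightarrow> (real \<Rightarrow> real) set" where
  "r_smooth r = {g \<in> C01. \<exists>K\<ge>0. \<forall>x h. x \<in> {0..1 - real r * h} \<longrightarrow> 0 < h \<longrightarrow>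
     \<bar>fwd_diff r h g x\<bar> \<le> K * h ^ r}"

lemma r_smoothI:
  assumes "g \<in> C01" "K \<ge> 0"
    "\<And>x h. x \<in> {0..1 - real r * h} \<Longrightarrow> 0 < h \<Longrightarrow> \<bar>fwd_diff r h g x\<bar> \<le> K * h ^ r"
  shows "g \<in> r_smooth r"
  using assms unfolding r_smooth_def by blast

lemma r_smooth_zero: "(\<lambda>_. 0) \<in> r_smooth r"
  by (rule r_smoothI[of _ 0]) (auto simp: C01_def fwd_diff_def)

lemma r_smooth_add_cmult:
  assumes "f \<in> r_smooth r" "g \<in> r_smooth r"
  shows "(\<lambda>x. f x + c * g x) \<in> r_smooth r"
proof -
  obtain K where K: "K \<ge> 0" "f \<in> C01"
    "\<And>x h. x \<in> {0..1 - real r * h} \<Longrightarrow> 0 < h \<Longrightarrow> \<bar>fwd_diff r h f x\<bar> \<le> K * h ^ r"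
    using assms(1) unfolding r_smooth_def by blast
  obtain L where L: "L \<ge> 0" "g \<in> C01"
    "\<And>x h. x \<in> {0..1 - real r * h} \<Longrightarrow> 0 < h \<Longrightarrow> \<bar>fwd_diff r h g x\<bar> \<le> L * h ^ r"
    using assms(2) unfolding r_smooth_def by blast
  show ?thesis
  proof (rule r_smoothI[of _ "K + \<bar>c\<bar> * L"])
    show "(\<lambda>x. f x + c * g x) \<in> C01"
      using K(2) L(2) by (auto simp: C01_def intro!: continuous_intros)
    fix x h :: real assume x: "x \<in> {0..1 - real r * h}" "0 < h"
    have "\<bar>fwd_diff r h (\<lambda>x. f x + c * g x) x\<bar> \<le> \<bar>fwd_diff r h f x\<bar> + \<bar>c\<bar> * \<bar>fwd_diff r h g x\<bar>"
      unfolding fwd_diff_add fwd_diff_cmult abs_mult[symmetric] by (rule abs_triangle_ineq)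
    also have "\<dots> \<le> K * h ^ r + \<bar>c\<bar> * (L * h ^ r)"
      by (intro add_mono mult_left_mono K(3) L(3) x) auto
    finally show "\<bar>fwd_diff r h (\<lambda>x. f x + c * g x) x\<bar> \<le> (K + \<bar>c\<bar> * L) * h ^ r"
      by (simp add: algebra_simps)
  qed (use K L in auto)
qed

text \<open>
  Since \<open>\<omega>\<close> is monotone, it is enough to compare each difference with its own step size.
\<close>

lemma smoothness_modulus_bigo:
  assumes \<omega>: "abstract_modulus \<omega>" and M: "M \<ge> 0"
    and "\<And>x h. x \<in> {0..1 - real r * h} \<Longrightarrow> 0 < h \<Longrightarrow> \<bar>fwd_diff r h f x\<bar> \<le> M * \<omega> (h ^ r)"
  shows "(\<lambda>\<delta>. smoothness_modulus r f \<delta>) \<in> O[at_right 0](\<lambda>\<delta>. \<omega> (\<delta> ^ r))"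
proof (rule bigoI[of _ M])
  have "\<bar>smoothness_modulus r f \<delta>\<bar> \<le> M * \<omega> (\<delta> ^ r)" if \<delta>: "\<delta> > 0" for \<delta>
  proof (rule smoothness_modulus_bound[OF \<delta>])
    fix x h assume x: "x \<in> {0..1 - real r * h}" "0 < h" "h \<le> \<delta>"
    have "\<bar>fwd_diff r h f x\<bar> \<le> M * \<omega> (h ^ r)" by (rule assms(3)[OF x(1,2)])
    also have "\<dots> \<le> M * \<omega> (\<delta> ^ r)"
      using x M by (intro mult_left_mono abstract_modulus_mono[OF \<omega>] power_mono) auto
    finally show "\<bar>fwd_diff r h f x\<bar> \<le> M * \<omega> (\<delta> ^ r)" .
  qed
  then show "eventually (\<lambda>\<delta>. norm (smoothness_modulus r f \<delta>) \<le> M * norm (\<omega> (\<delta> ^ r))) (at_right 0)"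
    using M abstract_modulus_pos[OF \<omega>]
    by (auto simp: eventually_at_right_field zero_less_power less_imp_le intro!: exI[of _ 1])
qed

text \<open>
  An abstract modulus cannot decay faster than linearly: \<open>\<omega> 1 * t \<le> 2 * \<omega> t\<close> for \<open>t \<le> 1\<close>.
\<close>

lemma r_smooth_modulus_bigo:
  assumes \<omega>: "abstract_modulus \<omega>" and g: "g \<in> r_smooth r"
  shows "(\<lambda>\<delta>. smoothness_modulus r g \<delta>) \<in> O[at_right 0](\<lambda>\<delta>. \<omega> (\<delta> ^ r))"
proof -
  obtain K where K: "K \<ge> 0"
    "\<And>x h. x \<in> {0..1 - real r * h} \<Longrightarrow> 0 < h \<Longrightarrow> \<bar>fwd_diff r h g x\<bar> \<le> K * h ^ r"
    using g unfolding r_smooth_def by blast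
  have \<omega>1: "\<omega> 1 > 0" by (rule abstract_modulus_pos[OF \<omega>]) simp
  show ?thesis
  proof (rule smoothness_modulus_bigo[OF \<omega>, of "2 * K / \<omega> 1"])
    fix x h assume x: "x \<in> {0..1 - real r * h}" "0 < h"
    have "h ^ r \<le> 1"
    proof (cases "r = 0")
      case False
      then have "1 * h \<le> real r * h" using x(2) by (intro mult_right_mono) auto
      then have "h \<le> 1" using x(1) by simp
      then show ?thesis using x(2) by (intro power_le_one) auto
    qed simp
    then have "\<omega> 1 / 1 \<le> 2 * (\<omega> (h ^ r) / h ^ r)"
      using x(2) by (intro abstract_modulus_quotient_le[OF \<omega>]) auto
    then have "h ^ r \<le> 2 / \<omega> 1 * \<omega> (h ^ r)"
      using x(2) \<omega>1 by (simp add: field_simps)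
    then have "K * h ^ r \<le> K * (2 / \<omega> 1 * \<omega> (h ^ r))" by (rule mult_left_mono[OF _ K(1)])
    with K(2)[OF x] show "\<bar>fwd_diff r h g x\<bar> \<le> 2 * K / \<omega> 1 * \<omega> (h ^ r)"
      by (simp add: mult_ac)
  qed (use K(1) \<omega>1 in auto)
qed

text \<open>
  A quantitative resonance principle. The functions \<open>h n\<close> are bounded by \<open>1\<close>, have an \<open>r\<close>-th
  derivative of size \<open>1 / p n\<close> in the sense of differences, and are badly approximated at index \<open>4 * n\<close>, whereas each fixed smooth function is
  approximated better than \<open>\<omega> (p n)\<close>. Summing the \<open>h n\<close> with weights \<open>\<omega> (p n)\<close> along a
  sparse sequence produces a single function that is as smooth as \<open>\<omega>\<close> permits and is
  approximated no better than \<open>\<omega> (p n)\<close> along that sequence.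
\<close>

lemma gliding_hump:
  fixes E :: "nat \<Rightarrow> (real \<Rightarrow> real) \<Rightarrow> real" and h :: "nat \<Rightarrow> real \<Rightarrow> real" and p :: "nat \<Rightarrow> real"
  assumes E_add: "\<And>n f g. n \<ge> 1 \<Longrightarrow> f \<in> C01 \<Longrightarrow> g \<in> C01 \<Longrightarrow>
      E (2 * n) (\<lambda>x. f x + g x) \<le> E n f + E n g"
    and E_scale: "\<And>n f c. n \<ge> 1 \<Longrightarrow> f \<in> C01 \<Longrightarrow> E n (\<lambda>x. c * f x) = \<bar>c\<bar> * E n f"
    and E_bound: "\<And>n f. n \<ge> 1 \<Longrightarrow> f \<in> C01 \<Longrightarrow> E n f \<le> D n * norm01 f"
    and E_decr: "\<And>n f. n \<ge> 1 \<Longrightarrow> f \<in> C01 \<Longrightarrow> E (n + 1) f \<le> E n f"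
    and \<omega>: "abstract_modulus \<omega>" and \<omega>_lim: "filterlim (\<lambda>\<delta>. \<omega> \<delta> / \<delta>) at_top (at_right 0)"
    and p: "\<And>n. n \<ge> 1 \<Longrightarrow> p n > 0" "p \<longlonglongrightarrow> 0"
    and N: "N \<ge> 1"
    and h_cont: "\<And>n. n \<ge> N \<Longrightarrow> continuous_on UNIV (h n)"
    and h_le: "\<And>n y. n \<ge> N \<Longrightarrow> \<bar>h n y\<bar> \<le> 1"
    and h_diff: "\<And>n x \<delta>. n \<ge> N \<Longrightarrow> \<delta> > 0 \<Longrightarrow> \<bar>fwd_diff r \<delta> (h n) x\<bar> \<le> K * (\<delta> ^ r / p n)"
    and h_far: "\<And>n. n \<ge> N \<Longrightarrow> E (4 * n) (h n) \<ge> 1"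
    and K: "K \<ge> 0"
    and small: "\<And>g. g \<in> r_smooth r \<Longrightarrow> (\<lambda>n. E n g) \<in> o[sequentially](\<lambda>n. \<omega> (p n))"
  shows "\<exists>f\<in>C01. (\<exists>M\<ge>0. \<forall>x \<delta>. \<delta> > 0 \<longrightarrow> \<bar>fwd_diff r \<delta> f x\<bar> \<le> M * \<omega> (\<delta> ^ r)) \<and>
     (\<lambda>n. E n f) \<notin> o[sequentially](\<lambda>n. \<omega> (p n))"
proof -
  define a where "a n = \<omega> (p n)" for n
  have a_pos: "a n > 0" if "n \<ge> 1" for n
    unfolding a_def by (rule abstract_modulus_pos[OF \<omega> p(1)[OF that]])
  have p_ev: "eventually (\<lambda>n. p n > 0) sequentially"
    using p(1) eventually_sequentially by blast
  have "continuous_on {0..} \<omega>" using \<omega> unfolding abstract_modulus_def by blast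
  then have "(\<omega> \<longlongrightarrow> \<omega> 0) (at 0 within {0..})"
    unfolding continuous_on_def by (rule bspec) simp
  moreover have "filterlim p (at 0 within {0..}) sequentially"
    using p(2) p_ev by (auto simp: filterlim_at elim: eventually_mono)
  ultimately have "(\<lambda>n. \<omega> (p n)) \<longlonglongrightarrow> \<omega> 0" by (rule filterlim_compose)
  then have a_lim: "a \<longlonglongrightarrow> 0"
    using \<omega> unfolding abstract_modulus_def a_def[abs_def] by auto
  have "filterlim p (at_right 0) sequentially"
    using p(2) p_ev by (auto simp: filterlim_at elim: eventually_mono)
  from filterlim_compose[OF \<omega>_lim this]
  have q_lim: "filterlim (\<lambda>n. a n / p n) at_top sequentially" by (simp add: a_def)
  have h_C01: "h n \<in> C01" if "n \<ge> N" for n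
    using h_cont[OF that] by (auto simp: C01_def intro: continuous_on_subset)
  have h_smooth: "h n \<in> r_smooth r" if "n \<ge> N" for n
    using that p(1)[of n] K N h_diff[OF that]
    by (intro r_smoothI[of _ "K / p n"] h_C01) (auto simp: less_imp_le)
  have small_ev: "eventually (\<lambda>n. E n g \<le> a n / 4) sequentially" if "g \<in> r_smooth r" for g
  proof -
    have "eventually (\<lambda>n. norm (E n g) \<le> 1 / 4 * norm (\<omega> (p n))) sequentially"
      by (rule landau_o.smallD[OF small[OF that]]) simp
    moreover have "eventually (\<lambda>n. n \<ge> 1) sequentially" by (rule eventually_ge_at_top)
    ultimately show ?thesis
    proof eventually_elim
      case (elim n)
      then show ?case using a_pos[of n] unfolding a_def by auto
    qed
  qed

  \<comment> \<open>The recursion runs on pairs \<open>(n, g)\<close> of an index and the partial sum \<open>g\<close> of all earlier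
    terms. Each new index is chosen so large that \<open>g\<close> is well approximated there, the new weight is
    negligible even against the constant \<open>D n\<close> of the current index, and the
    quotient \<open>a / p\<close> doubles. The \<open>2\<close> in the denominator makes the weights at least halve; the \<open>8\<close>
    makes \<open>\<bar>D n\<bar>\<close> times the norm of the remaining sum at most a quarter of the current weight.\<close>
  define admissible where "admissible k s \<longleftrightarrow> (k = 0 \<longrightarrow> snd s = (\<lambda>_. 0)) \<and> fst s \<ge> N \<and> fst s \<ge> k \<and>
      snd s \<in> r_smooth r \<and> E (fst s) (snd s) \<le> a (fst s) / 4"
    for k and s :: "nat \<times> (real \<Rightarrow> real)"
  define follows where "follows s s' \<longleftrightarrow>
      snd s' = (\<lambda>x. snd s x + a (fst s) * h (fst s) x) \<and>
      a (fst s') \<le> a (fst s) / (2 + 8 * \<bar>D (fst s)\<bar>) \<and>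
      2 * (a (fst s) / p (fst s)) \<le> a (fst s') / p (fst s')"
    for s s' :: "nat \<times> (real \<Rightarrow> real)"
  have "\<exists>S. \<forall>k. admissible k (S k) \<and> follows (S k) (S (Suc k))"
  proof (rule dependent_nat_choice)
    have "eventually (\<lambda>n. n \<ge> N \<and> E n (\<lambda>_. 0) \<le> a n / 4) sequentially"
      by (intro eventually_conj eventually_ge_at_top small_ev r_smooth_zero)
    then obtain n where "n \<ge> N" "E n (\<lambda>_. 0) \<le> a n / 4"
      by (auto dest!: eventually_happens)
    then show "\<exists>s. admissible 0 s"
      by (intro exI[of _ "(n, \<lambda>_. 0)"]) (auto simp: admissible_def r_smooth_zero)
  next
    fix s k assume "admissible k s"
    then have s: "fst s \<ge> N" "snd s \<in> r_smooth r" by (auto simp: admissible_def)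
    define g where "g = (\<lambda>x. snd s x + a (fst s) * h (fst s) x)"
    have g: "g \<in> r_smooth r" unfolding g_def by (intro r_smooth_add_cmult s h_smooth)
    have "0 < a (fst s) / (2 + 8 * \<bar>D (fst s)\<bar>)"
      using a_pos s(1) N by (intro divide_pos_pos) auto
    then have "eventually (\<lambda>n. a n < a (fst s) / (2 + 8 * \<bar>D (fst s)\<bar>)) sequentially"
      by (rule order_tendstoD(2)[OF a_lim])
    moreover have "eventually (\<lambda>n. 2 * (a (fst s) / p (fst s)) \<le> a n / p n) sequentially"
      using q_lim unfolding filterlim_at_top by blast
    ultimately have "eventually (\<lambda>n. n \<ge> N \<and> n \<ge> Suc k \<and> E n g \<le> a n / 4 \<and>
        a n < a (fst s) / (2 + 8 * \<bar>D (fst s)\<bar>) \<and>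
        2 * (a (fst s) / p (fst s)) \<le> a n / p n) sequentially"
      using g by (intro eventually_conj eventually_ge_at_top small_ev)
    then obtain n where "n \<ge> N" "n \<ge> Suc k" "E n g \<le> a n / 4"
        "a n < a (fst s) / (2 + 8 * \<bar>D (fst s)\<bar>)" "2 * (a (fst s) / p (fst s)) \<le> a n / p n"
      by (auto dest!: eventually_happens)
    then show "\<exists>s'. admissible (Suc k) s' \<and> follows s s'"
      using g by (intro exI[of _ "(n, g)"]) (auto simp: admissible_def follows_def g_def)
  qed
  then obtain S where S: "\<And>k. admissible k (S k)" "\<And>k. follows (S k) (S (Suc k))" by blast
  define n where "n k = fst (S k)" for k
  define g where "g k = snd (S k)" for k
  have n: "n k \<ge> N" "n k \<ge> k" and n1: "n k \<ge> 1" for k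
    using S(1)[of k] N by (auto simp: admissible_def n_def)
  have g0: "g 0 = (\<lambda>_. 0)" and g_smooth: "g k \<in> r_smooth r"
    and Eg: "E (n k) (g k) \<le> a (n k) / 4" for k
    using S(1)[of k] S(1)[of 0] by (auto simp: admissible_def n_def g_def)
  have gS: "g (Suc k) = (\<lambda>x. g k x + a (n k) * h (n k) x)"
    and aS: "a (n (Suc k)) \<le> a (n k) / (2 + 8 * \<bar>D (n k)\<bar>)"
    and qS: "2 * (a (n k) / p (n k)) \<le> a (n (Suc k)) / p (n (Suc k))" for k
    using S(2)[of k] by (auto simp: follows_def n_def g_def)
  have apos: "a (n k) > 0" for k by (rule a_pos[OF n1])
  have half: "a (n (Suc k)) \<le> a (n k) / 2" for k
    by (rule order_trans[OF aS]) (use apos[of k] in \<open>intro divide_left_mono; simp\<close>)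
  have n_lim: "filterlim n at_top sequentially"
    by (rule filterlim_at_top_mono[OF filterlim_ident]) (simp add: n)
  have pn_lim: "(\<lambda>k. p (n k)) \<longlonglongrightarrow> 0" by (rule filterlim_compose[OF p(2) n_lim])

  define u where "u k x = a (n k) * h (n k) x" for k x
  define f where "f x = (\<Sum>k. u k x)" for x
  have sum_a: "summable (\<lambda>k. a (n k))" and tail_a: "(\<Sum>i. a (n (i + k))) \<le> 2 * a (n k)" for k
    using halving_tail[of "\<lambda>k. a (n k)"] apos half by (auto intro: less_imp_le)
  have u_le: "\<bar>u k x\<bar> \<le> a (n k)" for k x
    using mult_mono[OF order_refl h_le[OF n(1)], of "a (n k)" k x] apos[of k]
    by (simp add: u_def abs_mult)
  have sum_u: "summable (\<lambda>k. u k x)" for x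
    using u_le by (intro summable_comparison_test'[OF sum_a, of 0]) auto
  have g_eq: "g k x = (\<Sum>j<k. u j x)" for k x
    by (induction k) (auto simp: g0 gS u_def)
  have g_C01: "g k \<in> C01" for k using g_smooth by (auto simp: r_smooth_def)
  have u_C01: "u k \<in> C01" for k
    using h_C01[OF n(1)] by (auto simp: u_def[abs_def] C01_def intro!: continuous_intros)
  have "uniform_limit {0..1} (\<lambda>k x. \<Sum>j<k. u j x) f sequentially"
    unfolding f_def[abs_def] using u_le by (intro Weierstrass_m_test[OF _ sum_a]) simp
  then have "uniform_limit {0..1} g f sequentially"
    by (simp add: g_eq[abs_def])
  moreover have "eventually (\<lambda>k. continuous_on {0..1} (g k)) sequentially"
    using g_C01 by (simp add: C01_def)
  ultimately have f_C01: "f \<in> C01"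
    unfolding C01_def by (auto intro: uniform_limit_theorem)

  have f_diff: "\<bar>fwd_diff r \<delta> f x\<bar> \<le> (2 * 2 ^ r + 4 * K) * \<omega> (\<delta> ^ r)" if \<delta>: "\<delta> > 0" for x \<delta>
  proof -
    have eq: "fwd_diff r \<delta> (u k) x = a (n k) * fwd_diff r \<delta> (h (n k)) x" for k
      unfolding u_def[abs_def] by (rule fwd_diff_cmult)
    have "(\<lambda>k. fwd_diff r \<delta> (u k) x) sums fwd_diff r \<delta> f x"
      unfolding f_def[abs_def] by (intro fwd_diff_sums summable_sums sum_u)
    then have "fwd_diff r \<delta> f x = (\<Sum>k. fwd_diff r \<delta> (u k) x)" by (rule sums_unique)
    also have "\<bar>\<dots>\<bar> \<le> (2 * 2 ^ r + 4 * K) * \<omega> (\<delta> ^ r)"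
    proof (rule lacunary_sum_le[where p = "\<lambda>k. p (n k)" and \<omega> = \<omega> and t = "\<delta> ^ r"])
      fix k
      show "\<bar>fwd_diff r \<delta> (u k) x\<bar> \<le> 2 ^ r * \<omega> (p (n k))"
        using abs_fwd_diff_le[OF u_le] by (simp add: a_def)
      show "\<bar>fwd_diff r \<delta> (u k) x\<bar> \<le> K * \<delta> ^ r * (\<omega> (p (n k)) / p (n k))"
        using mult_left_mono[OF h_diff[OF n(1) \<delta>], of "a (n k)" k x] apos[of k]
        unfolding eq by (simp add: abs_mult a_def mult_ac)
    qed (use \<omega> p(1) n1 pn_lim half qS K \<delta> in \<open>auto simp: a_def\<close>)
    finally show ?thesis .
  qed

  have E_double: "E (2 * m) f' \<le> E m f'" if "m \<ge> 1" "f' \<in> C01" for m f'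
  proof -
    have "E (m + i) f' \<le> E m f'" for i
    proof (induction i)
      case (Suc i)
      then show ?case using E_decr[of "m + i" f'] that by simp
    qed simp
    from this[of m] show ?thesis by (simp add: mult_2)
  qed
  have E_uminus: "E m (\<lambda>x. - f' x) = E m f'" if "m \<ge> 1" "f' \<in> C01" for m f'
    using E_scale[OF that, of "-1"] by simp
  have far: "E (n k) f \<ge> a (n k) / 2" for k
  proof -
    define T where "T x = (\<Sum>i. u (i + Suc k) x)" for x
    have f_split: "f x = g k x + u k x + T x" for x
      unfolding f_def T_def g_eq using suminf_split_initial_segment[OF sum_u[of x], of "Suc k"] by simp
    then have "T = (\<lambda>x. f x - g k x - u k x)" by (auto simp: fun_eq_iff)
    then have T: "T \<in> C01" using f_C01 g_C01[of k] u_C01[of k]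
      by (auto simp: C01_def intro!: continuous_intros)
    have "\<bar>T x\<bar> \<le> (\<Sum>i. a (n (i + Suc k)))" for x
      unfolding T_def using norm_suminf_le[of "\<lambda>i. u (i + Suc k) x" "\<lambda>i. a (n (i + Suc k))"] u_le sum_a
        summable_iff_shift[of "\<lambda>k. a (n k)" "Suc k"]
      by simp
    then have "\<bar>T x\<bar> \<le> 2 * a (n (Suc k))" for x using tail_a[of "Suc k"] order_trans by blast
    then have "norm01 T \<le> 2 * a (n (Suc k))" unfolding norm01_def by (intro cSUP_least) auto
    moreover have "0 \<le> norm01 T"
    proof -
      have "bdd_above ((\<lambda>x. \<bar>T x\<bar>) ` {0..1})"
        using \<open>\<And>x. \<bar>T x\<bar> \<le> 2 * a (n (Suc k))\<close> by (auto simp: bdd_above_def)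
      then show ?thesis unfolding norm01_def by (intro cSUP_upper2[of _ _ 0]) auto
    qed
    ultimately have "D (n k) * norm01 T \<le> \<bar>D (n k)\<bar> * (2 * a (n (Suc k)))"
      by (intro mult_mono) auto
    also have "\<dots> \<le> a (n k) / 4"
    proof -
      have "a (n (Suc k)) * (2 + 8 * \<bar>D (n k)\<bar>) \<le> a (n k)"
        using aS[of k] by (simp add: pos_le_divide_eq add_pos_nonneg)
      then show ?thesis using apos[of "Suc k"] by (simp add: algebra_simps)
    qed
    finally have ET: "E (n k) T \<le> a (n k) / 4" using E_bound[OF n1 T] by (rule order_trans[rotated])
    \<comment> \<open>Subadditivity isolates the term \<open>u k\<close>: from \<open>4 * n k\<close> to \<open>2 * n k\<close> it removes the partial
      sum \<open>g k\<close>, from \<open>2 * n k\<close> to \<open>n k\<close> the remainder \<open>T\<close>. Each costs a quarter of the weight.\<close>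
    have "a (n k) \<le> a (n k) * E (4 * n k) (h (n k))"
      using h_far[OF n(1), of k] apos[of k] by simp
    also have "\<dots> = E (4 * n k) (u k)"
      unfolding u_def[abs_def] using E_scale[OF _ h_C01[OF n(1)], of "4 * n k" "a (n k)" k] n1[of k] apos[of k] by simp
    also have "u k = (\<lambda>x. (f x + - T x) + - g k x)" using f_split by auto
    also have "E (4 * n k) \<dots> \<le> E (2 * n k) (\<lambda>x. f x + - T x) + E (2 * n k) (\<lambda>x. - g k x)"
      using E_add[of "2 * n k" "\<lambda>x. f x + - T x" "\<lambda>x. - g k x"] n1[of k] f_C01 T g_C01[of k]
      by (auto simp: C01_def continuous_intros)
    also have "E (2 * n k) (\<lambda>x. f x + - T x) \<le> E (n k) f + E (n k) (\<lambda>x. - T x)"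
      using T by (intro E_add n1 f_C01) (auto simp: C01_def intro!: continuous_intros)
    also have "E (n k) (\<lambda>x. - T x) = E (n k) T" by (rule E_uminus[OF n1 T])
    also have "E (2 * n k) (\<lambda>x. - g k x) = E (2 * n k) (g k)"
      using n1[of k] by (intro E_uminus g_C01) auto
    also have "\<dots> \<le> E (n k) (g k)" by (rule E_double[OF n1 g_C01])
    finally show ?thesis using ET Eg[of k] by linarith
  qed
  have "(\<lambda>n. E n f) \<notin> o[sequentially](\<lambda>n. \<omega> (p n))"
  proof
    assume "(\<lambda>n. E n f) \<in> o[sequentially](\<lambda>n. \<omega> (p n))"
    then have "eventually (\<lambda>n. norm (E n f) \<le> 1 / 4 * norm (\<omega> (p n))) sequentially"
      by (rule landau_o.smallD) simp
    then have "eventually (\<lambda>k. norm (E (n k) f) \<le> 1 / 4 * norm (\<omega> (p (n k)))) sequentially"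
      using n_lim by (rule eventually_compose_filterlim)
    then obtain k where "norm (E (n k) f) \<le> 1 / 4 * norm (a (n k))"
      by (auto simp: a_def dest!: eventually_happens)
    then show False using far[of k] apos[of k] by simp
  qed
  moreover have "2 * 2 ^ r + 4 * K \<ge> 0" using K by simp
  ultimately show ?thesis using f_C01 f_diff by blast
qed

theorem corollary4p3:
  fixes V :: "nat \<Rightarrow> (real \<Rightarrow> real) set"
    and E :: "nat \<Rightarrow> (real \<Rightarrow> real) \<Rightarrow> real"
    and D :: "nat \<Rightarrow> real"
    and \<tau> :: "nat \<Rightarrow> nat"
    and \<phi> :: "real \<Rightarrow> real"
    and C :: real
    and n0 r :: nat
    and \<omega> :: "real \<Rightarrow> real"
  assumes V_bounded: "\<And>n. n \<ge> 1 \<Longrightarrow> V n \<subseteq> B01"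
    and V_nonempty: "\<And>n. n \<ge> 1 \<Longrightarrow> V n \<noteq> {}"
    and E_eq: "\<And>n f. n \<ge> 1 \<Longrightarrow> E n f = approx_error (V n) f"
    and E_sum: "\<And>m n (f :: nat \<Rightarrow> real \<Rightarrow> real). m \<ge> 1 \<Longrightarrow> n \<ge> 1 \<Longrightarrow> (\<forall>k\<in>{1..m}. f k \<in> C01) \<Longrightarrow>
                  E (m * n) (\<lambda>x. \<Sum>k=1..m. f k x) \<le> (\<Sum>k=1..m. E n (f k))"
    and E_scale: "\<And>n f c. n \<ge> 1 \<Longrightarrow> f \<in> C01 \<Longrightarrow> E n (\<lambda>x. c * f x) = \<bar>c\<bar> * E n f"
    and E_bound: "\<And>n f. n \<ge> 1 \<Longrightarrow> f \<in> C01 \<Longrightarrow> E n f \<le> D n * norm01 f"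
    and E_decr: "\<And>n f. n \<ge> 1 \<Longrightarrow> f \<in> C01 \<Longrightarrow> E n f \<ge> E (n + 1) f"
    and \<tau>_pos: "\<And>n. n \<ge> 1 \<Longrightarrow> \<tau> n \<ge> 1"
    and \<phi>_pos: "\<And>x. x \<ge> 1 \<Longrightarrow> \<phi> x > 0"
    and \<phi>_decr: "strict_antimono_on {1..} \<phi>"
    and \<phi>_lim: "(\<phi> \<longlongrightarrow> 0) at_top"
    and \<phi>_regular: "\<And>l. 0 < l \<Longrightarrow> l < 1 \<Longrightarrow>
                  \<exists>X0 \<ge> inverse l. \<exists>C\<^sub>l > 0. \<forall>x > X0. \<phi> (l * x) \<le> C\<^sub>l * \<phi> x"
    and C_pos: "C > 0"
    and n0_pos: "n0 \<ge> 1"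
    and VC: "\<And>n. n \<ge> n0 \<Longrightarrow> VC_dim (grid (\<tau> n)) (grid_restriction (V n) (\<tau> n)) < \<tau> n"
    and \<tau>_bound: "\<And>n. n \<ge> n0 \<Longrightarrow> real (\<tau> (4 * n)) \<le> C / \<phi> (real n)"
    and r_pos: "r \<ge> 1"
    and \<omega>_modulus: "abstract_modulus \<omega>"
    and \<omega>_lim: "filterlim (\<lambda>\<delta>. \<omega> \<delta> / \<delta>) at_top (at_right 0)"
  shows "\<exists>f\<^sub>\<omega> \<in> C01.
           (\<lambda>\<delta>. smoothness_modulus r f\<^sub>\<omega> \<delta>) \<in> O[at_right 0](\<lambda>\<delta>. \<omega> (\<delta> ^ r)) \<and>
           (\<lambda>n. E n f\<^sub>\<omega>) \<notin> o[sequentially](\<lambda>n. \<omega> (\<phi> (real n) ^ r))"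
proof (cases "\<forall>g\<in>r_smooth r. (\<lambda>n. E n g) \<in> o[sequentially](\<lambda>n. \<omega> (\<phi> (real n) ^ r))")
  case False
  then obtain g where g: "g \<in> r_smooth r"
    "(\<lambda>n. E n g) \<notin> o[sequentially](\<lambda>n. \<omega> (\<phi> (real n) ^ r))" by blast
  then show ?thesis
    using r_smooth_modulus_bigo[OF \<omega>_modulus g(1)] by (auto simp: r_smooth_def)
next
  case True
  define p where "p n = \<phi> (real n) ^ r" for n
  have \<phi>_nat: "(\<lambda>n. \<phi> (real n)) \<longlonglongrightarrow> 0"
    by (rule filterlim_compose[OF \<phi>_lim filterlim_real_sequentially])
  have p_lim: "p \<longlonglongrightarrow> 0"
    using tendsto_power[OF \<phi>_nat, of r] r_pos by (simp add: p_def[abs_def] power_0_left)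
  obtain K where K: "K \<ge> 0" and train: "\<And>t s. t \<ge> 1 \<Longrightarrow> (\<And>i. \<bar>s i\<bar> \<le> 1) \<Longrightarrow>
    \<exists>h. continuous_on UNIV h \<and> (\<forall>y. \<bar>h y\<bar> \<le> 1) \<and> (\<forall>i\<in>{1..t}. h (real i / real t) = s i) \<and>
      (\<forall>x \<delta>. \<delta> > 0 \<longrightarrow> \<bar>fwd_diff r \<delta> h x\<bar> \<le> K * (real t * \<delta>) ^ r)"
    using bump_train[of r] by blast
  have "\<exists>h. continuous_on UNIV h \<and> (\<forall>y. \<bar>h y\<bar> \<le> 1) \<and>
      (\<forall>x \<delta>. \<delta> > 0 \<longrightarrow> \<bar>fwd_diff r \<delta> h x\<bar> \<le> K * C ^ r * (\<delta> ^ r / p n)) \<and> E (4 * n) h \<ge> 1"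
    if n: "n \<ge> n0" for n
  proof -
    have n1: "n \<ge> 1" using n n0_pos by simp
    define t where "t = \<tau> (4 * n)"
    have t1: "t \<ge> 1" using \<tau>_pos[of "4 * n"] n1 by (simp add: t_def)
    obtain s where s: "\<And>i. s i \<in> {-1, 1}"
      and no: "\<And>g. g \<in> V (4 * n) \<Longrightarrow>
        \<exists>i\<in>{1..t}. heaviside (g (real i / real t)) \<noteq> heaviside (s i)"
      by (rule VC_dim_unattained_signs[OF VC[of "4 * n"], folded t_def]) (use n in auto)
    have "\<bar>s i\<bar> \<le> 1" for i using s[of i] by auto
    from train[of t s, OF t1 this] obtain h where "continuous_on UNIV h \<and> (\<forall>y. \<bar>h y\<bar> \<le> 1) \<and>
      (\<forall>i\<in>{1..t}. h (real i / real t) = s i) \<and>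
      (\<forall>x \<delta>. \<delta> > 0 \<longrightarrow> \<bar>fwd_diff r \<delta> h x\<bar> \<le> K * (real t * \<delta>) ^ r)" ..
    then have h: "continuous_on UNIV h" "\<And>y. \<bar>h y\<bar> \<le> 1"
      "\<And>i. i \<in> {1..t} \<Longrightarrow> h (real i / real t) = s i"
      "\<And>x \<delta>. \<delta> > 0 \<Longrightarrow> \<bar>fwd_diff r \<delta> h x\<bar> \<le> K * (real t * \<delta>) ^ r" by auto
    have "E (4 * n) h = approx_error (V (4 * n)) h" using n1 by (intro E_eq) simp
    also have "\<dots> \<ge> 1"
      using n1 h(2) by (intro approx_error_ge_1[OF V_bounded V_nonempty _ h(3) s no])
        (auto simp: B01_def bounded_iff)
    finally have "E (4 * n) h \<ge> 1" .
    moreover have "\<bar>fwd_diff r \<delta> h x\<bar> \<le> K * C ^ r * (\<delta> ^ r / p n)" if \<delta>: "\<delta> > 0" for x \<delta>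
    proof -
      have "\<bar>fwd_diff r \<delta> h x\<bar> \<le> K * (real t * \<delta>) ^ r" by (rule h(4)[OF \<delta>])
      also have "\<dots> \<le> K * (C / \<phi> (real n) * \<delta>) ^ r"
        using \<tau>_bound[OF n] \<delta> K unfolding t_def
        by (intro mult_left_mono power_mono mult_right_mono) auto
      finally show ?thesis by (simp add: p_def power_mult_distrib power_divide mult_ac)
    qed
    ultimately show ?thesis using h(1,2) by blast
  qed
  then have "\<forall>n\<in>{n0..}. \<exists>h. continuous_on UNIV h \<and> (\<forall>y. \<bar>h y\<bar> \<le> 1) \<and>
      (\<forall>x \<delta>. \<delta> > 0 \<longrightarrow> \<bar>fwd_diff r \<delta> h x\<bar> \<le> K * C ^ r * (\<delta> ^ r / p n)) \<and> E (4 * n) h \<ge> 1"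
    by simp
  from bchoice[OF this] obtain h where "\<forall>n\<in>{n0..}. continuous_on UNIV (h n) \<and>
      (\<forall>y. \<bar>h n y\<bar> \<le> 1) \<and>
      (\<forall>x \<delta>. \<delta> > 0 \<longrightarrow> \<bar>fwd_diff r \<delta> (h n) x\<bar> \<le> K * C ^ r * (\<delta> ^ r / p n)) \<and>
      E (4 * n) (h n) \<ge> 1" ..
  then have h: "\<And>n. n \<ge> n0 \<Longrightarrow> continuous_on UNIV (h n)"
    "\<And>n y. n \<ge> n0 \<Longrightarrow> \<bar>h n y\<bar> \<le> 1"
    "\<And>n x \<delta>. n \<ge> n0 \<Longrightarrow> \<delta> > 0 \<Longrightarrow> \<bar>fwd_diff r \<delta> (h n) x\<bar> \<le> K * C ^ r * (\<delta> ^ r / p n)"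
    "\<And>n. n \<ge> n0 \<Longrightarrow> E (4 * n) (h n) \<ge> 1"
    by simp_all
  have E_add: "E (2 * n) (\<lambda>x. f x + g x) \<le> E n f + E n g"
    if "n \<ge> 1" "f \<in> C01" "g \<in> C01" for n f g
    using E_sum[of 2 n "\<lambda>k. if k = 1 then f else g"] that by (simp add: numeral_2_eq_2)
  have "\<exists>f\<in>C01. (\<exists>M\<ge>0. \<forall>x \<delta>. \<delta> > 0 \<longrightarrow> \<bar>fwd_diff r \<delta> f x\<bar> \<le> M * \<omega> (\<delta> ^ r)) \<and>
     (\<lambda>n. E n f) \<notin> o[sequentially](\<lambda>n. \<omega> (p n))"
  proof (rule gliding_hump[where E = E and D = D and h = h and p = p and N = n0
        and K = "K * C ^ r" and \<omega> = \<omega> and r = r,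
        OF E_add E_scale E_bound E_decr \<omega>_modulus \<omega>_lim _ p_lim n0_pos h])
    show "p n > 0" if "n \<ge> 1" for n using \<phi>_pos that by (simp add: p_def)
    show "0 \<le> K * C ^ r" using K C_pos by simp
    show "(\<lambda>n. E n g) \<in> o[sequentially](\<lambda>n. \<omega> (p n))" if "g \<in> r_smooth r" for g
      using True that by (simp add: p_def)
  qed
  then obtain f M where f: "f \<in> C01" "M \<ge> 0"
    "\<And>x \<delta>. \<delta> > 0 \<Longrightarrow> \<bar>fwd_diff r \<delta> f x\<bar> \<le> M * \<omega> (\<delta> ^ r)"
    "(\<lambda>n. E n f) \<notin> o[sequentially](\<lambda>n. \<omega> (p n))" by blast
  have "(\<lambda>\<delta>. smoothness_modulus r f \<delta>) \<in> O[at_right 0](\<lambda>\<delta>. \<omega> (\<delta> ^ r))"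
    by (rule smoothness_modulus_bigo[OF \<omega>_modulus f(2)]) (rule f(3))
  with f(1,4) show ?thesis by (auto simp: p_def)
qed

end
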